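(* Suppose that $S$ is an admissible pinnacle set with $|S|=d$ and $\max S=m$ (in particular $S$ is nonempty). Then for any $n\ge m$, $$p_S(n)=2^{n-m}\left((m-2d)\,p_{S\setminus\{m\}}(m-1)+2\sum_{j\in[m]\setminus S} p_{(S\setminus\{m\})\cup\{j\}}(m-1)\right).$$
   Context: Let $[n]=\{1,2,\ldots,n\}$ and let $S_n$ be the set of permutations of $[n]$, written as words $w=w(1)w(2)\cdots w(n)$. A pinnacle of $w\in S_n$ is a value $w(i)$ with $2\le i\le n-1$ and $w(i-1)<w(i)>w(i+1)$. The pinnacle set $\mathrm{Pin}(w)$ is the set of all pinnacles of $w$. A set $S$ is an admissible pinnacle set if $S=\mathrm{Pin}(w)$ for some $w\in S_k$ and some $k\ge1$. For a set $T$, $p_T(n)=|\{w\in S_n:\mathrm{Pin}(w)=T\}|$ (so $p_T(n)=0$ if no such $w$ exists). *)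

theory Defs
  imports "HOL-Combinatorics.Permutations"
begin

text \<open>
  Elements of the symmetric group on \<open>[n]\<close> are functions \<open>w\<close> with \<open>w permutes {1..n}\<close>; the word of
  \<open>w\<close> is \<open>w 1, \<dots>, w n\<close>. Such a \<open>w\<close> is the identity outside \<open>{1..n}\<close> and so does not determine \<open>n\<close>,
  which is why \<open>n\<close> is an argument of \<open>Pin\<close>.
\<close>

definition Pin :: "nat \<Rightarrow> (nat \<Rightarrow> nat) \<Rightarrow> nat set" where
  "Pin n w = {w i | i. 2 \<le> i \<and> i \<le> n - 1 \<and> w (i - 1) < w i \<and> w i > w (i + 1)}"

definition admissible_pinnacle_set :: "nat set \<Rightarrow> bool" where
  "admissible_pinnacle_set S \<longleftrightarrow> (\<exists>k\<ge>1. \<exists>w. w permutes {1..k} \<and> Pin k w = S)"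

definition pin_count :: "nat set \<Rightarrow> nat \<Rightarrow> nat" where
  "pin_count T n = card {w. w permutes {1..n} \<and> Pin n w = T}"

end

theory Submission
  imports Defs "HOL-Combinatorics.Multiset_Permutations"
begin

text \<open>
  Every word on \<open>[n + 1]\<close> arises uniquely from a word \<open>v\<close> on \<open>[n]\<close> by inserting the letter
  \<open>n + 1\<close> into one of the \<open>n + 1\<close> gaps of \<open>v\<close>. At either end of \<open>v\<close> the insertion leaves
  the pinnacle set unchanged, which accounts for the factor \<open>2\<close> for each letter above the largest
  pinnacle. In an inner gap it makes \<open>n + 1\<close> a pinnacle and destroys the pinnacle adjacent to the
  gap, if there is one; since two pinnacles are never adjacent, the gaps next to pinnacles are two
  for each pinnacle. Hence for \<open>m = n + 1\<close> in \<open>S\<close>, a word \<open>v\<close> with pinnacle set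
  \<open>S - {m}\<close> can be extended in \<open>(m - 2) - 2 (d - 1)\<close> ways, and one with pinnacle set
  \<open>(S - {m}) \<union> {j}\<close> in two.
\<close>

section \<open>Pinnacles of words written as lists\<close>

text \<open>Lists turn the insertion of a letter into a cut and an append. The recursion slides a
  window of three letters along the word, so end letters are never tested.\<close>

fun pins :: "nat list \<Rightarrow> nat set" where
  "pins (a # b # c # xs) = (if a < b \<and> c < b then {b} else {}) \<union> pins (b # c # xs)"
| "pins _ = {}"

lemma mem_pins_iff:
  "x \<in> pins xs \<longleftrightarrow> (\<exists>i. Suc (Suc i) < length xs \<and> x = xs ! Suc i \<and>
     xs ! i < xs ! Suc i \<and> xs ! Suc (Suc i) < xs ! Suc i)"
proof (induction xs rule: pins.induct)
  case (1 a b c xs)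
  \<comment> \<open>Index \<open>0\<close> is the leading window and the successors are the windows
    of the tail, which matches the recursion of \<open>pins\<close>.\<close>
  have split: "(\<exists>i. P i) \<longleftrightarrow> P 0 \<or> (\<exists>i. P (Suc i))" for P :: "nat \<Rightarrow> bool"
    by (metis not0_implies_Suc)
  show ?case
    unfolding pins.simps Un_iff 1
    by (subst split[where P = "\<lambda>i. Suc (Suc i) < length (a # b # c # xs) \<and>
      x = (a # b # c # xs) ! Suc i \<and>
      (a # b # c # xs) ! i < (a # b # c # xs) ! Suc i \<and>
      (a # b # c # xs) ! Suc (Suc i) < (a # b # c # xs) ! Suc i"]) auto
qed auto

lemma pins_subset: "pins xs \<subseteq> set xs"
  by (induction xs rule: pins.induct) auto

lemma finite_pins [simp]: "finite (pins xs)"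
  using pins_subset finite_set finite_subset by blast

text \<open>The two pieces overlap in the two letters \<open>x\<close> and \<open>y\<close>, so
  every window of three letters lies inside one of them.\<close>

lemma pins_append:
  "pins (us @ x # y # vs) = pins (us @ [x, y]) \<union> pins (x # y # vs)"
proof (induction us rule: pins.induct)
  case (1 a b c xs)
  then show ?case by auto
next
  case ("2_3" a b)
  then show ?case by auto
next
  case ("2_2" a)
  then show ?case by auto
qed auto

lemma pins_Cons_subset: "pins (x # xs) \<subseteq> set xs"
  by (induction "x # xs" arbitrary: x xs rule: pins.induct) auto

lemma pins_snoc_subset: "pins (xs @ [x]) \<subseteq> set xs"
proof (induction xs rule: pins.induct)
  case (1 a b c xs)
  then show ?case
    by (simp split: if_splits) blast
qed simp_all

text \<open>An end letter is no pinnacle. The letter next to \<open>N\<close> is smaller than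
  \<open>N\<close>, hence no pinnacle either, just as it is none at the end of
  \<open>xs\<close>.\<close>

lemma pins_Cons_max: "\<forall>x\<in>set xs. x < N \<Longrightarrow> pins (N # xs) = pins xs"
  by (cases xs rule: pins.cases) auto

lemma pins_snoc_max: "\<forall>x\<in>set xs. x < N \<Longrightarrow> pins (xs @ [N]) = pins xs"
  by (induction xs rule: pins.induct) auto

lemma pins_Cons_diff: "pins (x # y # xs) - {y} = pins (y # xs) - {y}"
  by (cases xs) auto

lemma pins_snoc_diff: "pins (xs @ [x, y]) - {x} = pins (xs @ [x]) - {x}"
  by (induction xs rule: pins.induct) auto

text \<open>\<open>N\<close> exceeds both neighbours, so it is a pinnacle and they are not; windows
  centred elsewhere stay as they were. Distinctness lets the removal of the values \<open>a\<close>
  and \<open>b\<close> affect only these two positions.\<close>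

lemma pins_insert_max:
  assumes "distinct (us @ a # b # vs)" and "\<forall>x\<in>set (us @ a # b # vs). x < N"
  shows "pins (us @ a # N # b # vs) = insert N (pins (us @ a # b # vs) - {a, b})"
proof -
  have "pins (us @ a # N # b # vs) = pins ((us @ [a]) @ [N]) \<union> pins (a # N # b # vs)"
    using pins_append[of us a N "b # vs"] by simp
  also have "pins ((us @ [a]) @ [N]) = pins (us @ [a])"
    using assms(2) by (intro pins_snoc_max) auto
  also have "pins (a # N # b # vs) = insert N (pins (b # vs))"
    using assms(2) pins_Cons_max[of "b # vs" N] by auto
  finally have 1: "pins (us @ a # N # b # vs) = insert N (pins (us @ [a]) \<union> pins (b # vs))"
    by auto
  have "pins (us @ [a]) - {a, b} = pins (us @ [a, b]) - {a, b}"
    using pins_snoc_diff[of us a b] by blast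
  moreover have "pins (b # vs) - {a, b} = pins (a # b # vs) - {a, b}"
    using pins_Cons_diff[of a b vs] by blast
  moreover have "pins (us @ [a]) = pins (us @ [a]) - {a, b}"
    using pins_snoc_subset[of us a] assms(1) by auto
  moreover have "pins (b # vs) = pins (b # vs) - {a, b}"
    using pins_Cons_subset[of b vs] assms(1) by auto
  ultimately show ?thesis
    unfolding 1 pins_append[of us a b vs] by blast
qed

section \<open>Inserting a letter into a gap\<close>

definition insert_at :: "nat \<Rightarrow> 'a \<Rightarrow> 'a list \<Rightarrow> 'a list" where
  "insert_at g x xs = take g xs @ x # drop g xs"

lemma pins_insert_at_max:
  assumes "distinct xs" and "\<forall>x\<in>set xs. x < N" and "g \<le> length xs"
  shows "pins (insert_at g N xs) =
    (if g = 0 \<or> g = length xs then pins xs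
     else insert N (pins xs - {xs ! (g - 1), xs ! g}))"
proof (cases "g = 0 \<or> g = length xs")
  case True
  then show ?thesis
    using assms(2) by (auto simp: insert_at_def pins_Cons_max pins_snoc_max)
next
  case False
  then obtain k where g: "g = Suc k" "Suc k < length xs"
    using assms(3) by (cases g) auto
  define us a b vs where "us = take k xs" and "a = xs ! k" and "b = xs ! g"
    and "vs = drop (Suc g) xs"
  have take: "take g xs = us @ [a]" and drop: "drop g xs = b # vs"
    using g by (auto simp: us_def a_def b_def vs_def take_Suc_conv_app_nth Cons_nth_drop_Suc)
  then have "xs = us @ a # b # vs"
    by (metis append_take_drop_id append.assoc append_Cons append_Nil)
  then show ?thesis
    using pins_insert_max[of us a b vs N] False assms take drop
    by (simp add: insert_at_def a_def b_def g(1))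
qed

text \<open>Since \<open>x\<close> is not in \<open>A\<close>, its place in the new word determines
  the gap, and deleting it recovers the old word.\<close>

lemma bij_betw_insert_at:
  assumes "finite A" and "x \<notin> A"
  shows "bij_betw (\<lambda>(xs, g). insert_at g x xs)
    (permutations_of_set A \<times> {0..card A}) (permutations_of_set (insert x A))"
  unfolding bij_betw_def
proof
  show "inj_on (\<lambda>(xs, g). insert_at g x xs) (permutations_of_set A \<times> {0..card A})"
  proof (rule inj_onI, clarsimp)
    fix xs g ys h
    assume xs: "xs \<in> permutations_of_set A" and ys: "ys \<in> permutations_of_set A"
      and "g \<le> card A" "h \<le> card A" and eq: "insert_at g x xs = insert_at h x ys"
    then have len: "g \<le> length xs" "h \<le> length ys"
      by (auto simp: length_finite_permutations_of_set)
    have "x \<notin> set xs" "x \<notin> set ys"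
      using xs ys assms(2) by (auto simp: permutations_of_set_def)
    then have "take g xs = take h ys \<and> drop g xs = drop h ys"
      using eq unfolding insert_at_def
      by (subst (asm) append_Cons_eq_iff) (auto dest: in_set_takeD in_set_dropD)
    then show "xs = ys \<and> g = h"
      using len by (metis append_take_drop_id length_take min.absorb2)
  qed
  show "(\<lambda>(xs, g). insert_at g x xs) ` (permutations_of_set A \<times> {0..card A}) =
    permutations_of_set (insert x A)"
  proof (intro equalityI subsetI)
    fix ys assume "ys \<in> (\<lambda>(xs, g). insert_at g x xs) ` (permutations_of_set A \<times> {0..card A})"
    then obtain xs g where *: "ys = insert_at g x xs" "set xs = A" "distinct xs"
      by (auto simp: permutations_of_set_def)
    have "set (take g xs) \<union> set (drop g xs) = A"
      using *(2) by (metis append_take_drop_id set_append)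
    then show "ys \<in> permutations_of_set (insert x A)"
      using * assms(2) by (auto simp: permutations_of_set_def insert_at_def set_take_disj_set_drop_if_distinct)
  next
    fix ys assume ys: "ys \<in> permutations_of_set (insert x A)"
    then obtain us vs where split: "ys = us @ x # vs"
      by (metis insertI1 permutations_of_setD(1) split_list)
    then have "us @ vs \<in> permutations_of_set A"
      using ys assms(2) by (auto simp: permutations_of_set_def)
    moreover from this have "length us \<le> card A"
      using length_finite_permutations_of_set by fastforce
    ultimately show "ys \<in> (\<lambda>(xs, g). insert_at g x xs) ` (permutations_of_set A \<times> {0..card A})"
      using split by (intro image_eqI[of _ _ "(us @ vs, length us)"]) (auto simp: insert_at_def)
  qed
qed

section \<open>From permutations to words\<close>

lemma Pin_eq_pins: "Pin n w = pins (map w [1..<Suc n])"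
proof -
  have "x \<in> Pin n w \<longleftrightarrow> x \<in> pins (map w [1..<Suc n])" for x
  proof -
    have "x \<in> Pin n w \<longleftrightarrow> (\<exists>i. 2 \<le> i \<and> i \<le> n - 1 \<and> x = w i \<and> w (i - 1) < w i \<and> w (i + 1) < w i)"
      by (auto simp: Pin_def)
    \<comment> \<open>The shift by two makes \<open>i\<close> the list index where the window
      starts: its centre has list index \<open>Suc i\<close>, and list indices are one less than
      positions.\<close>
    also have "\<dots> \<longleftrightarrow> (\<exists>i. Suc (Suc i) < n \<and> x = w (Suc (Suc i)) \<and>
        w (Suc i) < w (Suc (Suc i)) \<and> w (Suc (Suc (Suc i))) < w (Suc (Suc i)))"
      (is "(\<exists>i. ?P i) \<longleftrightarrow> (\<exists>i. ?Q i)")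
    proof
      assume "\<exists>i. ?P i"
      then obtain i where i: "?P i" ..
      then obtain j where "i = Suc (Suc j)" by (metis add_2_eq_Suc le_Suc_ex)
      then show "\<exists>i. ?Q i" using i by (intro exI[of _ j]) auto
    next
      assume "\<exists>i. ?Q i"
      then obtain i where "?Q i" ..
      then show "\<exists>i. ?P i" by (intro exI[of _ "Suc (Suc i)"]) auto
    qed
    also have "\<dots> \<longleftrightarrow> x \<in> pins (map w [1..<Suc n])"
      unfolding mem_pins_iff by (intro ex_cong1) (auto simp del: upt_Suc)
    finally show ?thesis .
  qed
  then show ?thesis by blast
qed

lemma bij_betw_word:
  "bij_betw (\<lambda>w. map w [1..<Suc n]) {w. w permutes {1..n}} (permutations_of_set {1..n})"
proof -
  let ?f = "\<lambda>w::nat \<Rightarrow> nat. map w [1..<Suc n]"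
  have set: "set [1..<Suc n] = {1..n}" by auto
  have inj: "inj_on ?f {w. w permutes {1..n}}"
  proof (rule inj_onI, rule ext)
    fix v w i assume vw: "v \<in> {w. w permutes {1..n}}" "w \<in> {w. w permutes {1..n}}" "?f v = ?f w"
    then have "\<forall>i\<in>{1..n}. v i = w i" unfolding map_eq_conv set by blast
    then show "v i = w i" using vw(1,2) by (cases "i \<in> {1..n}") (auto simp: permutes_def)
  qed
  moreover have "?f ` {w. w permutes {1..n}} \<subseteq> permutations_of_set {1..n}"
  proof (intro image_subsetI permutations_of_setI)
    fix w assume "w \<in> {w. w permutes {1..n}}"
    then have w: "w permutes {1..n}" by simp
    show "set (?f w) = {1..n}"
      unfolding set_map set using w by (rule permutes_image)
    show "distinct (?f w)"
      unfolding distinct_map using permutes_inj_on[OF w] by (simp del: upt_Suc)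
  qed
  \<comment> \<open>Surjectivity follows by counting: the image is a subset with the same finite
    number of elements, \<open>fact n\<close>.\<close>
  moreover have "card (?f ` {w. w permutes {1..n}}) = card (permutations_of_set {1..n})"
    using inj by (simp add: card_image card_permutations)
  ultimately show ?thesis
    unfolding bij_betw_def by (metis card_subset_eq finite_permutations_of_set)
qed

lemma pin_count_eq: "pin_count T n = card {xs \<in> permutations_of_set {1..n}. pins xs = T}"
proof -
  have "bij_betw (\<lambda>w. map w [1..<Suc n]) {w \<in> {w. w permutes {1..n}}. Pin n w = T}
    {xs \<in> permutations_of_set {1..n}. pins xs = T}"
    using bij_betw_word by (rule bij_betw_Collect) (simp add: Pin_eq_pins del: upt_Suc)
  then show ?thesis
    unfolding pin_count_def using bij_betw_same_card by fastforce
qed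

section \<open>Counting by the insertion of the largest letter\<close>

lemma pin_count_Suc:
  "pin_count S (Suc n) = (\<Sum>xs\<in>permutations_of_set {1..n}.
     card {g \<in> {0..n}. pins (insert_at g (Suc n) xs) = S})"
proof -
  let ?W = "permutations_of_set {1..n}"
  have "bij_betw (\<lambda>(xs, g). insert_at g (Suc n) xs) (?W \<times> {0..n}) (permutations_of_set {1..Suc n})"
    using bij_betw_insert_at[of "{1..n}" "Suc n"] by (simp add: atLeastAtMostSuc_conv)
  then have "bij_betw (\<lambda>(xs, g). insert_at g (Suc n) xs)
    {p \<in> ?W \<times> {0..n}. case p of (xs, g) \<Rightarrow> pins (insert_at g (Suc n) xs) = S}
    {xs \<in> permutations_of_set {1..Suc n}. pins xs = S}"
    by (rule bij_betw_Collect) auto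
  moreover have "{p \<in> ?W \<times> {0..n}. case p of (xs, g) \<Rightarrow> pins (insert_at g (Suc n) xs) = S} =
    (SIGMA xs:?W. {g \<in> {0..n}. pins (insert_at g (Suc n) xs) = S})"
    by auto
  ultimately show ?thesis
    unfolding pin_count_eq by (simp add: bij_betw_same_card[symmetric])
qed

lemma sum_Collect_eq_pin_count:
  "(\<Sum>xs\<in>permutations_of_set {1..n}. if pins xs = T then c else 0) = c * int (pin_count T n)"
  by (simp add: pin_count_eq sum.If_cases Int_def mult.commute)

text \<open>An inner gap would make \<open>Suc n\<close> a pinnacle, so only the two end gaps
  qualify; they differ because \<open>n \<ge> 1\<close>.\<close>

lemma pin_count_Suc_notin:
  assumes "Suc n \<notin> S" and "n \<ge> 1"
  shows "pin_count S (Suc n) = 2 * pin_count S n"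
proof -
  have "int (card {g \<in> {0..n}. pins (insert_at g (Suc n) xs) = S}) = (if pins xs = S then 2 else 0)"
    if "xs \<in> permutations_of_set {1..n}" for xs
  proof -
    have xs: "distinct xs" "\<forall>x\<in>set xs. x < Suc n" "length xs = n"
      using that by (auto simp: permutations_of_set_def length_finite_permutations_of_set)
    have "{g \<in> {0..n}. pins (insert_at g (Suc n) xs) = S} = (if pins xs = S then {0, n} else {})"
      using assms(1) by (auto simp: pins_insert_at_max xs split: if_splits)
    then show ?thesis using assms(2) by auto
  qed
  then have "int (pin_count S (Suc n)) =
      (\<Sum>xs\<in>permutations_of_set {1..n}. if pins xs = S then 2 else 0)"
    unfolding pin_count_Suc of_nat_sum by (intro sum.cong refl)
  then show ?thesis unfolding sum_Collect_eq_pin_count by linarith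
qed

section \<open>Inner gaps and the pinnacles beside them\<close>

text \<open>\<open>pins\<close> collects values; in a word without repetitions the value fixes the
  position, so the window witnessing it is centred at \<open>k\<close>.\<close>

lemma pins_nth_mem:
  assumes "distinct xs" and "k < length xs" and "xs ! k \<in> pins xs"
  shows "0 < k" and "Suc k < length xs" and "xs ! (k - 1) < xs ! k" and "xs ! Suc k < xs ! k"
proof -
  obtain i where i: "Suc (Suc i) < length xs" "xs ! k = xs ! Suc i"
      "xs ! i < xs ! Suc i" "xs ! Suc (Suc i) < xs ! Suc i"
    using assms(3) by (auto simp: mem_pins_iff)
  then have "k = Suc i"
    using assms by (simp add: nth_eq_iff_index_eq)
  then show "0 < k" "Suc k < length xs" "xs ! (k - 1) < xs ! k" "xs ! Suc k < xs ! k"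
    using i by auto
qed

lemma pins_not_adjacent:
  assumes "distinct xs" and "Suc k < length xs" and "xs ! k \<in> pins xs"
  shows "xs ! Suc k \<notin> pins xs"
proof
  assume "xs ! Suc k \<in> pins xs"
  then have "xs ! k < xs ! Suc k"
    using pins_nth_mem(3)[of xs "Suc k"] assms by simp
  moreover have "xs ! Suc k < xs ! k"
    using pins_nth_mem(4)[of xs k] assms by simp
  ultimately show False by simp
qed

lemma card_gaps_avoiding_pins:
  assumes "distinct xs" and "xs \<noteq> []"
  shows "int (card {g \<in> {1..<length xs}. pins xs - {xs ! (g - 1), xs ! g} = pins xs}) =
    int (length xs) - 1 - 2 * int (card (pins xs))"
proof -
  \<comment> \<open>Positions of pinnacles. Gap \<open>k\<close> lies just before position
    \<open>k\<close> and gap \<open>Suc k\<close> just after it, so \<open>P\<close> and its image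
    under \<open>Suc\<close> are the gaps to be excluded.\<close>
  define P where "P = {k. k < length xs \<and> xs ! k \<in> pins xs}"
  have fin: "finite P" by (simp add: P_def)
  have "(!) xs ` P = pins xs"
    using pins_subset[of xs] by (auto simp: P_def image_iff) (metis in_set_conv_nth subsetD)
  moreover have "inj_on ((!) xs) P"
    using assms(1) by (auto simp: P_def inj_on_def nth_eq_iff_index_eq)
  ultimately have card_P: "card P = card (pins xs)"
    by (metis card_image)
  have disj: "P \<inter> Suc ` P = {}"
    using pins_not_adjacent[OF assms(1)] by (auto simp: P_def)
  \<comment> \<open>A pinnacle is never an end letter, so both gaps beside it are inner
    ones.\<close>
  have sub: "P \<union> Suc ` P \<subseteq> {1..<length xs}"
    using pins_nth_mem(1,2)[OF assms(1)] by (fastforce simp: P_def)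
  have "{g \<in> {1..<length xs}. pins xs - {xs ! (g - 1), xs ! g} = pins xs} =
      {1..<length xs} - (P \<union> Suc ` P)" (is "?L = ?R")
  proof (intro set_eqI)
    fix g
    show "g \<in> ?L \<longleftrightarrow> g \<in> ?R"
      by (cases g) (auto simp: P_def)
  qed
  then have "card ?L = length xs - 1 - card (P \<union> Suc ` P)"
    using fin sub by (simp add: card_Diff_subset)
  moreover have "card (P \<union> Suc ` P) = 2 * card (pins xs)"
    using fin disj by (simp add: card_Un_disjoint card_image card_P)
  \<comment> \<open>This bound and the next keep the truncated subtractions exact when passing to
    integers.\<close>
  moreover have "card (P \<union> Suc ` P) \<le> length xs - 1"
    using card_mono[OF _ sub] by simp
  moreover have "length xs \<ge> 1"
    using assms(2) by (simp add: Suc_le_eq)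
  ultimately show ?thesis
    by linarith
qed

text \<open>To lose \<open>j\<close> the gap must touch it. Both gaps beside \<open>j\<close> work,
  as their other neighbour is no pinnacle and nothing else is lost.\<close>

lemma card_gaps_beside_pinnacle:
  assumes "distinct xs" and "pins xs = insert j T" and "j \<notin> T"
  shows "card {g \<in> {1..<length xs}. pins xs - {xs ! (g - 1), xs ! g} = T} = 2"
proof -
  obtain k where k: "k < length xs" "xs ! k = j"
    using assms(2) pins_subset[of xs] by (metis in_set_conv_nth insertI1 subsetD)
  then have mem: "xs ! k \<in> pins xs" using assms(2) by simp
  note * = pins_nth_mem[OF assms(1) k(1) mem]
  have "xs ! Suc k \<notin> pins xs"
    using pins_not_adjacent[OF assms(1) *(2) mem] .
  moreover have "xs ! (k - 1) \<notin> pins xs"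
    using pins_not_adjacent[OF assms(1), of "k - 1"] *(1) k(1) mem by auto
  moreover have "g \<in> {k, Suc k}"
    if "g \<in> {1..<length xs}" "pins xs - {xs ! (g - 1), xs ! g} = T" for g
  proof -
    have "xs ! k = xs ! (g - 1) \<or> xs ! k = xs ! g"
      using that(2) assms(2,3) k(2) by blast
    then show ?thesis
      using that(1) k(1) assms(1) by (auto simp: nth_eq_iff_index_eq)
  qed
  ultimately have "{g \<in> {1..<length xs}. pins xs - {xs ! (g - 1), xs ! g} = T} = {k, Suc k}"
    using assms(2,3) k *(1,2) by auto
  then show ?thesis by simp
qed

text \<open>At most one of the two letters beside a gap is a pinnacle, so filling the gap destroys
  at most one.\<close>

lemma gaps_pins_cases:
  assumes "distinct xs" and "g \<in> {1..<length xs}" and "pins xs - {xs ! (g - 1), xs ! g} = T"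
  shows "pins xs = T \<or> (\<exists>j. j \<notin> T \<and> pins xs = insert j T)"
proof -
  have "xs ! (g - 1) \<notin> pins xs \<or> xs ! g \<notin> pins xs"
    using pins_not_adjacent[OF assms(1), of "g - 1"] assms(2) by auto
  then consider "T = pins xs" | "T = pins xs - {xs ! g}" "xs ! g \<in> pins xs"
    | "T = pins xs - {xs ! (g - 1)}" "xs ! (g - 1) \<in> pins xs"
    using assms(3) by blast
  then show ?thesis by cases blast+
qed

text \<open>At most one term on the right comes from a true condition: \<open>pins xs\<close> is
  \<open>T\<close> itself, or exceeds it by one uniquely determined \<open>j\<close>, or no gap
  yields \<open>T\<close>.\<close>

lemma card_gaps:
  assumes xs: "xs \<in> permutations_of_set {1..n}" and "n \<ge> 1"
  shows "int (card {g \<in> {1..<n}. pins xs - {xs ! (g - 1), xs ! g} = T}) =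
    (if pins xs = T then int n - 1 - 2 * int (card T) else 0) +
    (\<Sum>j\<in>{1..n} - T. if pins xs = insert j T then 2 else 0)"
    (is "int (card ?G) = _ + ?sum")
proof -
  have len: "length xs = n" and dist: "distinct xs" and set: "set xs = {1..n}"
    using xs by (auto simp: permutations_of_set_def length_finite_permutations_of_set)
  consider "pins xs = T" | j where "j \<notin> T" "pins xs = insert j T"
    | "pins xs \<noteq> T" "\<forall>j. j \<notin> T \<longrightarrow> pins xs \<noteq> insert j T" by blast
  then show ?thesis
  proof cases
    case 1
    then have "?sum = 0" by (intro sum.neutral) auto
    have "xs \<noteq> []" using len assms(2) by auto
    from card_gaps_avoiding_pins[OF dist this, unfolded 1 len] \<open>?sum = 0\<close> show ?thesis
      unfolding 1 by (simp only: simp_thms if_True add_0_right)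
  next
    case 2
    then have "j \<in> {1..n} - T" using pins_subset[of xs] set by auto
    moreover have "?sum = (\<Sum>i\<in>{1..n} - T. if i = j then 2 else 0)"
      using 2 by (intro sum.cong) auto
    ultimately have "?sum = 2" by simp
    then show ?thesis
      using 2 card_gaps_beside_pinnacle[OF dist 2(2,1)] len by auto
  next
    case 3
    then have "?G = {}" using gaps_pins_cases[OF dist] len by blast
    moreover have "?sum = 0" using 3 by (intro sum.neutral) auto
    ultimately show ?thesis using 3 by simp
  qed
qed

lemma pin_count_Suc_in:
  assumes "Suc n \<in> S" and "n \<ge> 1"
  shows "int (pin_count S (Suc n)) =
    (int n - 1 - 2 * int (card (S - {Suc n}))) * int (pin_count (S - {Suc n}) n) +
    2 * (\<Sum>j\<in>{1..n} - (S - {Suc n}). int (pin_count (insert j (S - {Suc n})) n))"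
proof -
  let ?W = "permutations_of_set {1..n}"
  define T where "T = S - {Suc n}"
  have "{g \<in> {0..n}. pins (insert_at g (Suc n) xs) = S} =
      {g \<in> {1..<n}. pins xs - {xs ! (g - 1), xs ! g} = T}"
    if "xs \<in> ?W" for xs
  proof -
    have xs: "distinct xs" "\<forall>x\<in>set xs. x < Suc n" "length xs = n"
      using that by (auto simp: permutations_of_set_def length_finite_permutations_of_set)
    \<comment> \<open>The letter \<open>Suc n\<close> is new to \<open>xs\<close> but belongs to
      \<open>S\<close>, so end gaps contribute nothing and an inner gap must leave exactly
      \<open>T\<close>.\<close>
    then have "Suc n \<notin> pins xs" using pins_subset[of xs] by auto
    then have "insert (Suc n) (pins xs - A) = S \<longleftrightarrow> pins xs - A = T" and "pins xs \<noteq> S" for A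
      using assms(1) unfolding T_def by blast+
    then have "pins (insert_at g (Suc n) xs) = S \<longleftrightarrow>
        g \<in> {1..<n} \<and> pins xs - {xs ! (g - 1), xs ! g} = T" if "g \<le> n" for g
      using that pins_insert_at_max[OF xs(1,2), of g] by (auto simp: xs(3))
    then show ?thesis
      by (intro Collect_cong) (metis atLeastAtMost_iff atLeastLessThan_iff le0 less_imp_le)
  qed
  then have "int (pin_count S (Suc n)) =
      (\<Sum>xs\<in>?W. int (card {g \<in> {1..<n}. pins xs - {xs ! (g - 1), xs ! g} = T}))"
    by (simp add: pin_count_Suc)
  also have "\<dots> = (\<Sum>xs\<in>?W. if pins xs = T then int n - 1 - 2 * int (card T) else 0) +
      (\<Sum>xs\<in>?W. \<Sum>j\<in>{1..n} - T. if pins xs = insert j T then 2 else 0)"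
    unfolding sum.distrib[symmetric] by (intro sum.cong refl card_gaps assms(2))
  \<comment> \<open>Exchanging the sums counts, for each \<open>j\<close>, the words that have
    \<open>j\<close> as their one extra pinnacle.\<close>
  also have "(\<Sum>xs\<in>?W. \<Sum>j\<in>{1..n} - T. if pins xs = insert j T then 2 else 0) =
      (\<Sum>j\<in>{1..n} - T. 2 * int (pin_count (insert j T) n))"
    unfolding sum_Collect_eq_pin_count[symmetric] by (rule sum.swap)
  finally show ?thesis
    unfolding sum_Collect_eq_pin_count T_def sum_distrib_left .
qed

section \<open>The formula for all \<open>n \<ge> m\<close>\<close>

theorem proposition3p7:
  fixes S :: "nat set" and d m n :: nat
  assumes "admissible_pinnacle_set S"
    and "S \<noteq> {}"
    and "card S = d"
    and "Max S = m"
    and "n \<ge> m"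
  shows "int (pin_count S n) =
    2 ^ (n - m) *
      ((int m - 2 * int d) * int (pin_count (S - {m}) (m - 1))
       + 2 * (\<Sum>j\<in>{1..m} - S. int (pin_count ((S - {m}) \<union> {j}) (m - 1))))"
proof -
  obtain k w where w: "w permutes {1..k}" "Pin k w = S"
    using assms(1) by (auto simp: admissible_pinnacle_set_def)
  have fin: "finite S" unfolding w(2)[symmetric] Pin_eq_pins by (rule finite_pins)
  have m: "m \<in> S" using Max_in[OF fin assms(2)] assms(4) by simp
  then obtain i where i: "2 \<le> i" "i \<le> k - 1" "m = w i" "w (i - 1) < w i"
    unfolding w(2)[symmetric] Pin_def by blast
  \<comment> \<open>The left neighbour of the pinnacle \<open>m\<close> is a smaller letter and at
    least \<open>1\<close>; hence \<open>m \<ge> 2\<close>, and the recursion applies to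
    \<open>m - 1 \<ge> 1\<close>.\<close>
  have "i - 1 \<in> {1..k}" using i(1,2) by auto
  then have "w (i - 1) \<in> {1..k}" by (simp only: permutes_in_image[OF w(1)])
  then have "m \<ge> 2" using i(3,4) by simp
  then obtain l where l: "m = Suc l" "l \<ge> 1" by (cases m) auto
  have "card S = Suc (card (S - {m}))" using card_Suc_Diff1[OF fin m] by simp
  \<comment> \<open>With \<open>l = m - 1\<close> and one pinnacle removed, the number of free inner
    gaps is \<open>(m - 2) - 2 * (d - 1)\<close>.\<close>
  then have d: "int l - 1 - 2 * int (card (S - {m})) = int m - 2 * int d"
    using assms(3) l by linarith
  have J: "{1..l} - (S - {m}) = {1..m} - S" using l(1) m by (auto simp: le_Suc_eq)
  have base: "int (pin_count S m) = (int m - 2 * int d) * int (pin_count (S - {m}) (m - 1))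
      + 2 * (\<Sum>j\<in>{1..m} - S. int (pin_count ((S - {m}) \<union> {j}) (m - 1)))"
    using pin_count_Suc_in[of l S, folded l(1), OF m l(2)]
    unfolding d J by (simp only: l(1) diff_Suc_1 Un_insert_right Un_empty_right)
  \<comment> \<open>Every letter above \<open>m = Max S\<close> lies outside \<open>S\<close>, so
    each of the \<open>n - m\<close> insertions doubles the count.\<close>
  have "pin_count S n = 2 ^ (n - m) * pin_count S m"
    using assms(5)
  proof (induction n rule: dec_induct)
    case (step q)
    have "Suc q \<notin> S" using Max_ge[OF fin, of "Suc q"] assms(4) step.hyps(1) by auto
    moreover have "q \<ge> 1" using step.hyps(1) \<open>m \<ge> 2\<close> by simp
    ultimately show ?case
      by (simp add: pin_count_Suc_notin step.IH Suc_diff_le[OF step.hyps(1)])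
  qed simp
  then show ?thesis using base by (simp only: of_nat_mult of_nat_power of_nat_numeral)
qed

end
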